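(* Let $\eta\ge0$. Suppose $\mu_1$ satisfies the weighted Poincaré inequality $$\mathrm{Var}_{\mu_1}(f)\le C_1\int U^{-2\eta}|\nabla f|^2d\mu_1\quad\text{for all smooth }f\text{ on }\mathbb R^d.$$ Then for all smooth $h$ on $\mathbb R^{2d}$, $$\mathrm{Var}_\mu(h)\le C'\int\big(H^{-2\eta}|\nabla_xh|^2+|\nabla_yh|^2\big)d\mu,\qquad C'\le\max\Big(2+\frac4{M_2},\ \frac{4C_1}{M_2}\Big),$$ where $M_2=\int(1+\frac12|y|^2)^{-2\eta}\mu_2(dy)$.
   Context: $U:\mathbb R^d\to\mathbb R$ smooth, $U\ge1$, $\int e^{-U}dx<\infty$, $H(x,y)=U(x)+\frac12|y|^2$, $\mu=Z^{-1}e^{-H}dxdy$ on $\mathbb R^{2d}$. Then $\mu=\mu_1\otimes\mu_2$ where $\mu_1(dx)=Z_1^{-1}e^{-U(x)}dx$ and $\mu_2$ is the standard Gaussian measure on $\mathbb R^d$. $\mathrm{Var}_\nu(g)=\int g^2d\nu-(\int gd\nu)^2$. *)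

theory Defs
  imports "HOL-Analysis.Analysis"
begin

text \<open>Smooth (C-infinity) real functions on a Euclidean space: differentiable everywhere,
  and every partial derivative along a basis vector is again smooth (greatest fixed point,
  i.e. partial derivatives of all orders exist).\<close>
coinductive smooth :: "('a::euclidean_space \<Rightarrow> real) \<Rightarrow> bool" where
  "(\<forall>x. f differentiable (at x)) \<Longrightarrow>
   (\<forall>b\<in>Basis. smooth (\<lambda>x. frechet_derivative f (at x) b)) \<Longrightarrow> smooth f"

definition Var :: "'b measure \<Rightarrow> ('b \<Rightarrow> real) \<Rightarrow> ereal" where
  "Var \<nu> g = (if integrable \<nu> (\<lambda>x. (g x)\<^sup>2)
     then ereal ((\<integral>x. (g x)\<^sup>2 \<partial>\<nu>) - (\<integral>x. g x \<partial>\<nu>)\<^sup>2) else \<infinity>)"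

definition grad_sq :: "('a::euclidean_space \<Rightarrow> real) \<Rightarrow> 'a \<Rightarrow> real" where
  "grad_sq f x = (\<Sum>b\<in>Basis. (frechet_derivative f (at x) b)\<^sup>2)"

definition grad_x_sq :: "('a::euclidean_space \<times> 'a \<Rightarrow> real) \<Rightarrow> 'a \<times> 'a \<Rightarrow> real" where
  "grad_x_sq h p = (\<Sum>b\<in>Basis. (frechet_derivative h (at p) (b, 0))\<^sup>2)"

definition grad_y_sq :: "('a::euclidean_space \<times> 'a \<Rightarrow> real) \<Rightarrow> 'a \<times> 'a \<Rightarrow> real" where
  "grad_y_sq h p = (\<Sum>b\<in>Basis. (frechet_derivative h (at p) (0, b))\<^sup>2)"

definition Hfun :: "('a::euclidean_space \<Rightarrow> real) \<Rightarrow> 'a \<times> 'a \<Rightarrow> real" where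
  "Hfun U p = U (fst p) + (norm (snd p))\<^sup>2 / 2"

definition mu1 :: "('a::euclidean_space \<Rightarrow> real) \<Rightarrow> 'a measure" where
  "mu1 U = density lborel (\<lambda>x. ennreal (exp (- U x) / (\<integral>z. exp (- U z) \<partial>lborel)))"

definition mu2 :: "'a::euclidean_space measure" where
  "mu2 = density lborel (\<lambda>y. ennreal ((2 * pi) powr (- real DIM('a) / 2) * exp (- (norm y)\<^sup>2 / 2)))"

definition mu :: "('a::euclidean_space \<Rightarrow> real) \<Rightarrow> ('a \<times> 'a) measure" where
  "mu U = density lborel (\<lambda>p. ennreal (exp (- Hfun U p) / (\<integral>q. exp (- Hfun U q) \<partial>lborel)))"

end

theory Submission
  imports Defs "HOL-Probability.Distributions"
begin

text \<open>
  Fix \<open>z\<close>. With \<open>c\<close> the \<open>\<mu>\<^sub>1\<close>-mean of \<open>h(\<cdot>,z)\<close>, integrating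
  \<open>(h(x,y) - c)\<^sup>2 \<le> 4/3 (h(x,y) - h(x,z))\<^sup>2 + 4 (h(x,z) - c)\<^sup>2\<close> bounds \<open>Var\<^sub>\<mu>(h)\<close> by increments of \<open>h\<close>
  in \<open>y\<close> and the variance of \<open>h(\<cdot>,z)\<close>. This is averaged over \<open>z\<close> with the weight
  \<open>w(z) = (1 + |z|\<^sup>2/2)\<^sup>-\<^sup>2\<^sup>\<eta> \<le> 1\<close>, whose \<open>\<mu>\<^sub>2\<close>-mass is \<open>M\<^sub>2\<close>. For the variances, the weighted
  inequality for \<open>h(\<cdot>,z)\<close> applies, and \<open>H(x,z) \<le> U(x) (1 + |z|\<^sup>2/2)\<close> because \<open>U \<ge> 1\<close>. For the
  increments, a Gaussian Poincare inequality with the constant \<open>\<pi>\<^sup>2/8\<close> suffices, since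
  \<open>4/3 \<cdot> 2 \<cdot> \<pi>\<^sup>2/8 \<le> 4\<close>; it follows by moving from \<open>y\<close> to \<open>z\<close> along the arc
  \<open>cos t \<cdot> y + sin t \<cdot> z\<close> and using the rotation invariance of \<open>\<mu>\<^sub>2 \<otimes> \<mu>\<^sub>2\<close>.
\<close>

section \<open>Smooth functions\<close>

lemma smooth_differentiable: "smooth f \<Longrightarrow> f differentiable (at x)"
  by (erule smooth.cases) auto

lemma smooth_partial_derivative:
  "smooth f \<Longrightarrow> b \<in> Basis \<Longrightarrow> smooth (\<lambda>x. frechet_derivative f (at x) b)"
  by (erule smooth.cases) auto

lemma smooth_continuous_on: "smooth f \<Longrightarrow> continuous_on A f"
  by (meson smooth_differentiable differentiable_imp_continuous_on differentiable_on_def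
      differentiable_at_withinI)

lemma smooth_borel_measurable: "smooth f \<Longrightarrow> f \<in> borel_measurable borel"
  by (intro borel_measurable_continuous_onI smooth_continuous_on)

lemma smooth_linear_combination:
  fixes f :: "'i \<Rightarrow> 'a::euclidean_space \<Rightarrow> real"
  assumes "\<And>i. i \<in> I \<Longrightarrow> smooth (f i)"
  shows "smooth (\<lambda>x. \<Sum>i\<in>I. c i * f i x)"
  using assms
proof (coinduction arbitrary: f)
  case smooth
  have deriv: "((\<lambda>x. \<Sum>i\<in>I. c i * f i x) has_derivative
      (\<lambda>v. \<Sum>i\<in>I. c i * frechet_derivative (f i) (at x) v)) (at x)" for x
    using smooth
    by (intro has_derivative_sum has_derivative_mult_right)
       (auto simp: frechet_derivative_works[symmetric] smooth_differentiable)
  have "frechet_derivative (\<lambda>x. \<Sum>i\<in>I. c i * f i x) (at x) b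
      = (\<Sum>i\<in>I. c i * frechet_derivative (f i) (at x) b)" for x b
    by (simp only: frechet_derivative_at[OF deriv, symmetric])
  moreover have "(\<lambda>x. \<Sum>i\<in>I. c i * f i x) differentiable at x" for x
    using deriv by (rule differentiableI)
  ultimately show ?case
    using smooth
    by (intro exI[of _ "\<lambda>x. \<Sum>i\<in>I. c i * f i x"] conjI refl ballI disjI1 allI
        exI[of _ "\<lambda>i x. frechet_derivative (f i) (at x) _"]) (auto intro: smooth_partial_derivative)
qed

definition gradient :: "('a::euclidean_space \<Rightarrow> real) \<Rightarrow> 'a \<Rightarrow> 'a" where
  "gradient f x = (\<Sum>b\<in>Basis. frechet_derivative f (at x) b *\<^sub>R b)"

lemma frechet_derivative_eq_gradient:
  assumes "f differentiable (at x)"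
  shows "frechet_derivative f (at x) v = gradient f x \<bullet> v"
proof -
  interpret D: linear "frechet_derivative f (at x)"
    using assms by (rule linear_frechet_derivative)
  have "frechet_derivative f (at x) v = frechet_derivative f (at x) (\<Sum>b\<in>Basis. (v \<bullet> b) *\<^sub>R b)"
    by (simp add: euclidean_representation)
  also have "\<dots> = (\<Sum>b\<in>Basis. (v \<bullet> b) * frechet_derivative f (at x) b)"
    by (simp add: D.sum D.scaleR)
  finally show ?thesis
    by (simp add: gradient_def inner_sum_left inner_commute[of v] mult.commute)
qed

lemma smooth_has_derivative:
  "smooth f \<Longrightarrow> (f has_derivative (\<lambda>v. gradient f x \<bullet> v)) (at x)"
  by (metis (no_types, lifting) ext frechet_derivative_eq_gradient frechet_derivative_works
      smooth_differentiable)

lemma continuous_on_gradient: "smooth f \<Longrightarrow> continuous_on A (gradient f)"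
  unfolding gradient_def
  by (intro continuous_intros smooth_continuous_on smooth_partial_derivative)

lemma gradient_borel_measurable: "smooth f \<Longrightarrow> gradient f \<in> borel_measurable borel"
  by (intro borel_measurable_continuous_onI continuous_on_gradient)

lemma grad_sq_eq_norm_gradient: "grad_sq f x = (norm (gradient f x))\<^sup>2"
  unfolding power2_norm_eq_inner
  by (simp add: grad_sq_def gradient_def inner_sum_left inner_sum_right inner_Basis
      power2_eq_square if_distrib[of "\<lambda>x. _ * x"] sum.delta cong: if_cong)

lemma smooth_directional_derivative:
  assumes "smooth f"
  shows "smooth (\<lambda>x. frechet_derivative f (at x) v)"
proof -
  have "frechet_derivative f (at x) v = (\<Sum>b\<in>Basis. (b \<bullet> v) * frechet_derivative f (at x) b)" for x
    unfolding frechet_derivative_eq_gradient[OF smooth_differentiable[OF assms], of _ v]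
    by (simp add: gradient_def inner_sum_left mult.commute)
  then show ?thesis
    using assms by (simp add: smooth_linear_combination smooth_partial_derivative)
qed

lemma has_derivative_compose_affine:
  fixes L :: "'a::euclidean_space \<Rightarrow> 'b::euclidean_space"
  assumes "linear L" "f differentiable (at (L x + c))"
  shows "((\<lambda>x. f (L x + c)) has_derivative (\<lambda>v. frechet_derivative f (at (L x + c)) (L v))) (at x)"
  using assms
  by (intro has_derivative_compose[where f="\<lambda>x. L x + c" and g=f])
     (auto simp: frechet_derivative_works[symmetric]
       intro!: derivative_eq_intros linear_imp_has_derivative)

lemmas frechet_derivative_compose_affine =
  has_derivative_compose_affine[THEN frechet_derivative_at, symmetric]

lemma smooth_compose_affine:
  fixes L :: "'a::euclidean_space \<Rightarrow> 'b::euclidean_space"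
  assumes "linear L" "smooth f"
  shows "smooth (\<lambda>x. f (L x + c))"
  using assms(2)
proof (coinduction arbitrary: f)
  case smooth
  note deriv = has_derivative_compose_affine[OF assms(1) smooth_differentiable[OF smooth]]
  then have "(\<lambda>x. f (L x + c)) differentiable at x" for x
    by (rule differentiableI)
  moreover have "frechet_derivative (\<lambda>x. f (L x + c)) (at x) b
      = frechet_derivative f (at (L x + c)) (L b)" for x b
    by (simp only: frechet_derivative_at[OF deriv, symmetric])
  ultimately show ?case
    using smooth_directional_derivative[OF smooth]
    by (intro exI[of _ "\<lambda>x. f (L x + c)"] conjI refl ballI disjI1 allI
        exI[of _ "\<lambda>y. frechet_derivative f (at y) (L _)"]) auto
qed

lemma linear_Pair_zero: "linear (\<lambda>x. (x, 0))" "linear (\<lambda>y. (0, y))"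
  by (simp_all add: linear_iff)

lemma
  assumes "smooth h"
  shows smooth_slice_fst: "smooth (\<lambda>x. h (x, y))"
    and smooth_slice_snd: "smooth (\<lambda>y. h (x, y))"
  using smooth_compose_affine[OF linear_Pair_zero(1) assms, of "(0, y)"]
    smooth_compose_affine[OF linear_Pair_zero(2) assms, of "(x, 0)"] by simp_all

lemma grad_sq_slice_fst: "smooth h \<Longrightarrow> grad_sq (\<lambda>x. h (x, y)) x = grad_x_sq h (x, y)"
  using frechet_derivative_compose_affine[OF linear_Pair_zero(1), of h x "(0, y)"]
  by (simp add: grad_sq_def grad_x_sq_def smooth_differentiable)

lemma grad_sq_slice_snd: "smooth h \<Longrightarrow> grad_sq (\<lambda>y. h (x, y)) y = grad_y_sq h (x, y)"
  using frechet_derivative_compose_affine[OF linear_Pair_zero(2), of h y "(x, 0)"]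
  by (simp add: grad_sq_def grad_y_sq_def smooth_differentiable)

lemma grad_x_sq_borel_measurable: "smooth h \<Longrightarrow> grad_x_sq h \<in> borel_measurable borel"
  unfolding grad_x_sq_def
  by (intro borel_measurable_sum borel_measurable_power smooth_borel_measurable
      smooth_directional_derivative)

lemma grad_y_sq_borel_measurable: "smooth h \<Longrightarrow> grad_y_sq h \<in> borel_measurable borel"
  unfolding grad_y_sq_def
  by (intro borel_measurable_sum borel_measurable_power smooth_borel_measurable
      smooth_directional_derivative)

lemma grad_x_sq_nonneg [simp]: "0 \<le> grad_x_sq h p"
  by (simp add: grad_x_sq_def sum_nonneg)

lemma grad_y_sq_nonneg [simp]: "0 \<le> grad_y_sq h p"
  by (simp add: grad_y_sq_def sum_nonneg)

section \<open>Variance\<close>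

definition nn_variance :: "'b measure \<Rightarrow> ('b \<Rightarrow> real) \<Rightarrow> ennreal" where
  "nn_variance M g = (\<integral>\<^sup>+x. ennreal ((g x - (\<integral>y. g y \<partial>M))\<^sup>2) \<partial>M)"

lemma (in finite_measure) square_integrable_diff_const:
  fixes g :: "'a \<Rightarrow> real"
  assumes [measurable]: "g \<in> borel_measurable M" and sq: "integrable M (\<lambda>x. (g x)\<^sup>2)"
  shows "integrable M (\<lambda>x. (g x - c)\<^sup>2)"
proof -
  have "integrable M g"
    using square_integrable_imp_integrable[OF _ sq] by simp
  with sq show ?thesis
    by (simp add: power2_diff)
qed

lemma (in prob_space) nn_integral_deviation_sq_eq_ennreal:
  fixes g :: "'a \<Rightarrow> real"
  assumes [measurable]: "g \<in> borel_measurable M" and sq: "integrable M (\<lambda>x. (g x)\<^sup>2)"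
  shows "(\<integral>\<^sup>+x. ennreal ((g x - c)\<^sup>2) \<partial>M) = ennreal (variance g + (expectation g - c)\<^sup>2)"
proof -
  have "integrable M g"
    using square_integrable_imp_integrable[OF _ sq] by simp
  have "(\<integral>\<^sup>+x. ennreal ((g x - c)\<^sup>2) \<partial>M) = ennreal (\<integral>x. (g x - c)\<^sup>2 \<partial>M)"
    by (rule nn_integral_eq_integral[OF square_integrable_diff_const[OF _ sq]]) auto
  also have "(\<integral>x. (g x - c)\<^sup>2 \<partial>M) = variance g + (expectation g - c)\<^sup>2"
    using sq \<open>integrable M g\<close>
    by (simp add: variance_eq power2_diff prob_space power2_eq_square[of "expectation g"])
  finally show ?thesis .
qed

lemma (in prob_space) nn_integral_deviation_sq_eq_top:
  fixes g :: "'a \<Rightarrow> real"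
  assumes [measurable]: "g \<in> borel_measurable M" and "\<not> integrable M (\<lambda>x. (g x)\<^sup>2)"
  shows "(\<integral>\<^sup>+x. ennreal ((g x - c)\<^sup>2) \<partial>M) = top"
proof (rule ccontr)
  assume "(\<integral>\<^sup>+x. ennreal ((g x - c)\<^sup>2) \<partial>M) \<noteq> top"
  then have "integrable M (\<lambda>x. (g x - c)\<^sup>2)"
    by (intro integrableI_bounded) (auto simp: less_top)
  with square_integrable_diff_const[of "\<lambda>x. g x - c" "- c"] assms(2) show False by simp
qed

lemma (in prob_space) nn_integral_deviation_sq:
  fixes g :: "'a \<Rightarrow> real"
  assumes "g \<in> borel_measurable M"
  shows "(\<integral>\<^sup>+x. ennreal ((g x - c)\<^sup>2) \<partial>M) = nn_variance M g + ennreal ((expectation g - c)\<^sup>2)"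
proof (cases "integrable M (\<lambda>x. (g x)\<^sup>2)")
  case True
  show ?thesis
    by (simp add: nn_variance_def nn_integral_deviation_sq_eq_ennreal[OF assms True] variance_positive)
next
  case False
  show ?thesis
    by (simp add: nn_variance_def nn_integral_deviation_sq_eq_top[OF assms False])
qed

lemma (in prob_space) nn_variance_le_nn_integral:
  fixes g :: "'a \<Rightarrow> real"
  shows "g \<in> borel_measurable M \<Longrightarrow> nn_variance M g \<le> (\<integral>\<^sup>+x. ennreal ((g x - c)\<^sup>2) \<partial>M)"
  by (simp add: nn_integral_deviation_sq)

lemma (in prob_space) nn_integral_increment_sq:
  fixes g :: "'a \<Rightarrow> real"
  assumes [measurable]: "g \<in> borel_measurable M"
  shows "(\<integral>\<^sup>+x. \<integral>\<^sup>+y. ennreal ((g y - g x)\<^sup>2) \<partial>M \<partial>M) = 2 * nn_variance M g"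
proof -
  have "(\<integral>\<^sup>+x. \<integral>\<^sup>+y. ennreal ((g y - g x)\<^sup>2) \<partial>M \<partial>M)
      = (\<integral>\<^sup>+x. nn_variance M g + ennreal ((g x - expectation g)\<^sup>2) \<partial>M)"
    by (simp add: nn_integral_deviation_sq power2_commute[of "expectation g"])
  also have "\<dots> = 2 * nn_variance M g"
    by (simp add: nn_integral_add emeasure_space_1 nn_variance_def mult_2)
  finally show ?thesis .
qed

lemma (in prob_space) Var_eq_nn_variance:
  assumes "g \<in> borel_measurable M"
  shows "Var M g = enn2ereal (nn_variance M g)"
proof (cases "integrable M (\<lambda>x. (g x)\<^sup>2)")
  case True
  have "enn2ereal (nn_variance M g) = ereal (variance g)"
    by (simp add: nn_variance_def nn_integral_deviation_sq_eq_ennreal[OF assms True] variance_positive)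
  also have "\<dots> = Var M g"
    using True variance_eq[OF square_integrable_imp_integrable[OF assms True] True]
    by (simp add: Var_def)
  finally show ?thesis ..
next
  case False
  then show ?thesis
    by (simp add: Var_def nn_variance_def nn_integral_deviation_sq_eq_top[OF assms False])
qed

lemma (in prob_space) Var_le_if_nn_variance_le:
  assumes "g \<in> borel_measurable M" and "0 \<le> c" and "nn_variance M g \<le> ennreal c * I"
  shows "Var M g \<le> ereal c * enn2ereal I"
  using assms
  by (simp add: Var_eq_nn_variance less_eq_ennreal.rep_eq times_ennreal.rep_eq)

text \<open>For \<open>c < 0\<close> the coefficient \<open>ennreal c\<close> is \<open>0\<close>.\<close>
lemma (in prob_space) nn_variance_le_if_Var_le:
  assumes "g \<in> borel_measurable M" and "Var M g \<le> ereal c * enn2ereal I"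
  shows "nn_variance M g \<le> ennreal c * I"
proof -
  have "enn2ereal (nn_variance M g) \<le> ereal c * enn2ereal I"
    using assms by (simp add: Var_eq_nn_variance)
  also have "\<dots> \<le> ereal (max 0 c) * enn2ereal I"
    by (intro ereal_mult_right_mono) auto
  also have "\<dots> = enn2ereal (ennreal c * I)"
    by (simp add: times_ennreal.rep_eq ennreal.rep_eq zero_ereal_def)
  finally show ?thesis
    by (simp add: less_eq_ennreal.rep_eq)
qed

section \<open>Orthogonal invariance of Lebesgue measure\<close>

definition hyperplane_reflection :: "'a::real_inner \<Rightarrow> 'a \<Rightarrow> 'a" where
  "hyperplane_reflection w x = x - (2 * (w \<bullet> x) / (w \<bullet> w)) *\<^sub>R w"

lemma orthogonal_transformation_hyperplane_reflection:
  "orthogonal_transformation (hyperplane_reflection w)"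
proof -
  have "norm (hyperplane_reflection w x) = norm x" for x
    unfolding norm_eq hyperplane_reflection_def
    by (cases "w = 0") (simp_all add: inner_diff_left inner_diff_right inner_commute field_simps)
  moreover have "linear (hyperplane_reflection w)"
    unfolding linear_iff hyperplane_reflection_def
    by (simp add: inner_add_right add_divide_distrib algebra_simps)
  ultimately show ?thesis
    by (simp add: orthogonal_transformation)
qed

lemma hyperplane_reflection_diff:
  assumes "norm a = norm b"
  shows "hyperplane_reflection (a - b) a = b"
proof (cases "a = b")
  case False
  have "2 * ((a - b) \<bullet> a) = (a - b) \<bullet> (a - b)"
    using assms by (simp add: norm_eq inner_diff_left inner_diff_right inner_commute)
  with False show ?thesis
    by (simp add: hyperplane_reflection_def)
qed (simp add: hyperplane_reflection_def)

lemma nn_integral_lborel_translate: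
  fixes f :: "'a::euclidean_space \<Rightarrow> ennreal"
  assumes [measurable]: "f \<in> borel_measurable borel"
  shows "(\<integral>\<^sup>+x. f (x + c) \<partial>lborel) = (\<integral>\<^sup>+x. f x \<partial>lborel)"
proof -
  have "(\<integral>\<^sup>+x. f x \<partial>lborel) = (\<integral>\<^sup>+x. f x \<partial>distr lborel borel ((+) c))"
    by (simp add: lborel_distr_plus)
  also have "\<dots> = (\<integral>\<^sup>+x. f (x + c) \<partial>lborel)"
    by (subst nn_integral_distr) (auto simp: add.commute)
  finally show ?thesis by simp
qed

lemma orthogonal_transformation_borel_measurable:
  fixes T :: "'a::euclidean_space \<Rightarrow> 'a"
  shows "orthogonal_transformation T \<Longrightarrow> T \<in> borel_measurable borel"
  using linear_continuous_on[of T UNIV]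
  by (simp add: borel_measurable_continuous_onI linear_conv_bounded_linear[symmetric]
      orthogonal_transformation_linear)

lemma nn_integral_indicator_ball_orthogonal_transformation:
  fixes T :: "'a::euclidean_space \<Rightarrow> 'a"
  assumes T: "orthogonal_transformation T" and "0 \<le> r"
  shows "(\<integral>\<^sup>+x. indicator (ball 0 r) (y - T x) \<partial>lborel) = emeasure lborel (ball (0::'a) r)"
proof -
  have "T (inv T y) = y"
    using orthogonal_transformation_surj[OF T] by (rule surj_f_inv_f)
  then have "norm (T x - y) = norm (inv T y - x)" for x
    using orthogonal_transformation_norm[OF T, of "inv T y - x"]
    by (simp add: linear_diff[OF orthogonal_transformation_linear[OF T]] norm_minus_commute)
  then have "indicator (ball 0 r) (y - T x) = (indicator (ball (inv T y) r) x :: ennreal)" for x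
    by (simp add: indicator_def dist_norm)
  then show ?thesis
    using \<open>0 \<le> r\<close> by (simp add: emeasure_ball)
qed

text \<open>Uniqueness of Haar measure, with the unit ball as the normalising set: it is invariant
  under \<open>T\<close> and \<open>x \<mapsto> -x\<close>.\<close>
lemma nn_integral_lborel_orthogonal_transformation:
  fixes f :: "'a::euclidean_space \<Rightarrow> ennreal" and T :: "'a \<Rightarrow> 'a"
  assumes [measurable]: "f \<in> borel_measurable borel" and T: "orthogonal_transformation T"
  shows "(\<integral>\<^sup>+x. f (T x) \<partial>lborel) = (\<integral>\<^sup>+x. f x \<partial>lborel)"
proof -
  define B :: "'a \<Rightarrow> ennreal" where "B = indicator (ball 0 1)"
  define \<beta> where "\<beta> = emeasure lborel (ball (0::'a) 1)"
  note [measurable] = orthogonal_transformation_borel_measurable[OF T]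
  have [measurable]: "B \<in> borel_measurable borel"
    unfolding B_def by (rule borel_measurable_indicator) simp
  have nn_B: "(\<integral>\<^sup>+y. B y \<partial>lborel) = \<beta>" and nn_B_T: "(\<integral>\<^sup>+x. B (y - T x) \<partial>lborel) = \<beta>" for y
    by (simp_all add: B_def \<beta>_def nn_integral_indicator_ball_orthogonal_transformation[OF T])
  have translate: "(\<integral>\<^sup>+x. f (T x) \<partial>lborel) = (\<integral>\<^sup>+x. f (T x + y) \<partial>lborel)" for y
    using nn_integral_lborel_translate[of "\<lambda>x. f (T x)" "inv T y"]
    by (simp add: linear_add[OF orthogonal_transformation_linear[OF T]]
        surj_f_inv_f[OF orthogonal_transformation_surj[OF T]])
  have "\<beta> * (\<integral>\<^sup>+x. f (T x) \<partial>lborel) = (\<integral>\<^sup>+y. (\<integral>\<^sup>+x. f (T x) \<partial>lborel) * B y \<partial>lborel)"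
    by (simp add: nn_integral_cmult nn_B mult.commute[of \<beta>])
  also have "\<dots> = (\<integral>\<^sup>+y. \<integral>\<^sup>+x. f (T x + y) * B y \<partial>lborel \<partial>lborel)"
    by (rule nn_integral_cong) (simp add: nn_integral_multc translate[symmetric])
  also have "\<dots> = (\<integral>\<^sup>+x. \<integral>\<^sup>+y. f (y + T x) * B y \<partial>lborel \<partial>lborel)"
    by (subst add.commute) (rule lborel_pair.Fubini'; measurable)
  also have "\<dots> = (\<integral>\<^sup>+x. \<integral>\<^sup>+y. f y * B (y - T x) \<partial>lborel \<partial>lborel)"
  proof (rule nn_integral_cong)
    fix x
    show "(\<integral>\<^sup>+y. f (y + T x) * B y \<partial>lborel) = (\<integral>\<^sup>+y. f y * B (y - T x) \<partial>lborel)"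
      using nn_integral_lborel_translate[of "\<lambda>y. f y * B (y - T x)" "T x"] by simp
  qed
  also have "\<dots> = (\<integral>\<^sup>+y. \<integral>\<^sup>+x. f y * B (y - T x) \<partial>lborel \<partial>lborel)"
    by (rule lborel_pair.Fubini') measurable
  also have "\<dots> = \<beta> * (\<integral>\<^sup>+y. f y \<partial>lborel)"
    by (simp add: nn_integral_cmult nn_integral_multc nn_B_T mult.commute)
  finally have "\<beta> * (\<integral>\<^sup>+x. f (T x) \<partial>lborel) = \<beta> * (\<integral>\<^sup>+y. f y \<partial>lborel)" .
  moreover have "0 < \<beta>" "\<beta> < top"
    by (simp_all add: \<beta>_def emeasure_ball)
  ultimately show ?thesis
    by (auto simp: ennreal_mult_cancel_left)
qed

section \<open>Gibbs measures and the Gaussian\<close>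

lemma integral_pos:
  fixes f :: "'a \<Rightarrow> real"
  assumes int: "integrable M f" and pos: "\<And>x. 0 < f x" and M: "emeasure M (space M) \<noteq> 0"
  shows "0 < (\<integral>x. f x \<partial>M)"
proof -
  have "(\<integral>x. f x \<partial>M) \<noteq> 0"
  proof
    assume "(\<integral>x. f x \<partial>M) = 0"
    then have "AE x in M. f x = 0"
      using int pos by (subst (asm) integral_nonneg_eq_0_iff_AE) (auto intro: less_imp_le)
    then have "AE x in M. False"
      by eventually_elim (use pos in \<open>auto simp: less_le\<close>)
    then show False
      using M by (simp add: AE_iff_measurable[OF sets.top])
  qed
  moreover have "0 \<le> (\<integral>x. f x \<partial>M)"
    using pos by (simp add: less_imp_le)
  ultimately show ?thesis by simp
qed

lemma integral_exp_pos:
  fixes U :: "'a::euclidean_space \<Rightarrow> real"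
  shows "integrable lborel (\<lambda>x. exp (- U x)) \<Longrightarrow> 0 < (\<integral>x. exp (- U x) \<partial>lborel)"
  by (rule integral_pos) auto

lemma sets_mu1 [measurable_cong, simp]: "sets (mu1 U) = sets borel"
  by (simp add: mu1_def)

lemma prob_space_mu1:
  assumes "integrable lborel (\<lambda>x. exp (- U x))"
  shows "prob_space (mu1 U)"
proof
  let ?Z = "\<integral>x. exp (- U x) \<partial>lborel"
  note Z = integral_exp_pos[OF assms]
  have "(\<integral>\<^sup>+x. ennreal (exp (- U x) / ?Z) \<partial>lborel) = ennreal (\<integral>x. exp (- U x) / ?Z \<partial>lborel)"
    using assms Z by (intro nn_integral_eq_integral) auto
  also have "\<dots> = 1"
    using Z by simp
  finally show "emeasure (mu1 U) (space (mu1 U)) = 1"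
    using borel_measurable_integrable[OF assms]
    by (simp add: mu1_def emeasure_density)
qed

lemma nn_integral_mu1:
  assumes "integrable lborel (\<lambda>x. exp (- U x))" and [measurable]: "f \<in> borel_measurable borel"
  shows "(\<integral>\<^sup>+x. f x \<partial>mu1 U)
    = (\<integral>\<^sup>+x. ennreal (exp (- U x) / (\<integral>z. exp (- U z) \<partial>lborel)) * f x \<partial>lborel)"
  using borel_measurable_integrable[OF assms(1)]
  unfolding mu1_def by (subst nn_integral_density) auto

lemma nn_integral_mu1_orthogonal_transformation:
  assumes int: "integrable lborel (\<lambda>x. exp (- U x))" and [measurable]: "f \<in> borel_measurable borel"
    and T: "orthogonal_transformation T" and U: "\<And>x. U (T x) = U x"
  shows "(\<integral>\<^sup>+x. f (T x) \<partial>mu1 U) = (\<integral>\<^sup>+x. f x \<partial>mu1 U)"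
proof -
  let ?F = "\<lambda>x. ennreal (exp (- U x) / (\<integral>z. exp (- U z) \<partial>lborel)) * f x"
  note [measurable] =
    borel_measurable_integrable[OF int] orthogonal_transformation_borel_measurable[OF T]
  have "(\<integral>\<^sup>+x. f (T x) \<partial>mu1 U) = (\<integral>\<^sup>+x. ?F (T x) \<partial>lborel)"
    by (simp add: nn_integral_mu1[OF int] U)
  also have "\<dots> = (\<integral>\<^sup>+x. ?F x \<partial>lborel)"
    by (rule nn_integral_lborel_orthogonal_transformation[OF _ T]) measurable
  also have "\<dots> = (\<integral>\<^sup>+x. f x \<partial>mu1 U)"
    by (simp add: nn_integral_mu1[OF int])
  finally show ?thesis .
qed

lemma (in pair_sigma_finite) has_bochner_integral_pair_mult:
  fixes f :: "'a \<Rightarrow> real" and g :: "'b \<Rightarrow> real"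
  assumes f: "integrable M1 f" "\<And>x. 0 \<le> f x" and g: "integrable M2 g" "\<And>y. 0 \<le> g y"
  shows "has_bochner_integral (M1 \<Otimes>\<^sub>M M2) (\<lambda>p. f (fst p) * g (snd p))
    ((\<integral>x. f x \<partial>M1) * (\<integral>y. g y \<partial>M2))"
proof (rule has_bochner_integral_nn_integral)
  note [measurable] = borel_measurable_integrable[OF f(1)] borel_measurable_integrable[OF g(1)]
  show "(\<lambda>p. f (fst p) * g (snd p)) \<in> borel_measurable (M1 \<Otimes>\<^sub>M M2)"
    by measurable
  have "(\<integral>\<^sup>+p. ennreal (f (fst p) * g (snd p)) \<partial>(M1 \<Otimes>\<^sub>M M2))
      = (\<integral>\<^sup>+x. \<integral>\<^sup>+y. ennreal (f x) * ennreal (g y) \<partial>M2 \<partial>M1)"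
    by (subst M2.nn_integral_fst[symmetric]) (auto simp: ennreal_mult f g)
  also have "\<dots> = ennreal ((\<integral>x. f x \<partial>M1) * (\<integral>y. g y \<partial>M2))"
    by (simp add: nn_integral_cmult nn_integral_multc nn_integral_eq_integral f g ennreal_mult)
  finally show "(\<integral>\<^sup>+p. ennreal (f (fst p) * g (snd p)) \<partial>(M1 \<Otimes>\<^sub>M M2))
      = ennreal ((\<integral>x. f x \<partial>M1) * (\<integral>y. g y \<partial>M2))" .
qed (simp_all add: f g)

lemma
  fixes U :: "'a::euclidean_space \<Rightarrow> real" and V :: "'b::euclidean_space \<Rightarrow> real"
  assumes U: "integrable lborel (\<lambda>x. exp (- U x))" and V: "integrable lborel (\<lambda>y. exp (- V y))"
  shows integrable_exp_add: "integrable lborel (\<lambda>p. exp (- (U (fst p) + V (snd p))))"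
    and pair_measure_mu1: "mu1 U \<Otimes>\<^sub>M mu1 V = mu1 (\<lambda>p. U (fst p) + V (snd p))"
proof -
  let ?ZU = "\<integral>x. exp (- U x) \<partial>lborel" and ?ZV = "\<integral>y. exp (- V y) \<partial>lborel"
  interpret V: prob_space "mu1 V"
    by (rule prob_space_mu1[OF V])
  note [measurable] = borel_measurable_integrable[OF U] borel_measurable_integrable[OF V]
  have exp_add: "exp (- (U x + V y)) = exp (- U x) * exp (- V y)" for x y
    by (simp add: mult_exp_exp)
  have prod: "has_bochner_integral lborel (\<lambda>p. exp (- (U (fst p) + V (snd p)))) (?ZU * ?ZV)"
    unfolding exp_add lborel_prod[symmetric]
    by (rule lborel_pair.has_bochner_integral_pair_mult) (simp_all add: U V)
  then show "integrable lborel (\<lambda>p. exp (- (U (fst p) + V (snd p))))"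
    by (rule integrable.intros)
  have "mu1 U \<Otimes>\<^sub>M mu1 V
      = density lborel (\<lambda>(x, y). ennreal (exp (- U x) / ?ZU) * ennreal (exp (- V y) / ?ZV))"
    using V.sigma_finite_measure_axioms
    unfolding mu1_def lborel_prod[symmetric]
    by (intro pair_measure_density lborel.sigma_finite_measure_axioms) auto
  also have "\<dots> = mu1 (\<lambda>p. U (fst p) + V (snd p))"
    unfolding mu1_def has_bochner_integral_integral_eq[OF prod] unfolding exp_add
    by (simp add: case_prod_unfold ennreal_mult'[symmetric])
  finally show "mu1 U \<Otimes>\<^sub>M mu1 V = mu1 (\<lambda>p. U (fst p) + V (snd p))" .
qed

lemma gaussian_density_eq_prod:
  fixes y :: "'a::euclidean_space"
  shows "(2 * pi) powr (- real DIM('a) / 2) * exp (- (norm y)\<^sup>2 / 2)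
       = (\<Prod>b\<in>Basis. std_normal_density (y \<bullet> b))"
proof -
  have "(\<Prod>b\<in>(Basis::'a set). 1 / sqrt (2 * pi)) = ((2 * pi) powr (- 1 / 2)) ^ DIM('a)"
    by (simp add: powr_half_sqrt powr_minus_divide power_one_over)
  also have "\<dots> = (2 * pi) powr (- real DIM('a) / 2)"
    by (simp add: powr_power)
  finally have const: "(\<Prod>b\<in>(Basis::'a set). 1 / sqrt (2 * pi)) = (2 * pi) powr (- real DIM('a) / 2)" .
  have "(norm y)\<^sup>2 = (\<Sum>b\<in>Basis. (y \<bullet> b)\<^sup>2)"
    unfolding power2_norm_eq_inner by (subst euclidean_inner) (simp add: power2_eq_square)
  then have "exp (- (norm y)\<^sup>2 / 2) = (\<Prod>b\<in>Basis. exp (- (y \<bullet> b)\<^sup>2 / 2))"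
    by (simp add: exp_sum[symmetric] sum_negf sum_divide_distrib)
  with const show ?thesis
    by (simp only: std_normal_density_def prod.distrib)
qed

lemma nn_integral_mu2_prod:
  fixes f :: "'a::euclidean_space \<Rightarrow> real \<Rightarrow> ennreal"
  assumes [measurable]: "\<And>b. b \<in> Basis \<Longrightarrow> f b \<in> borel_measurable borel"
  shows "(\<integral>\<^sup>+y. (\<Prod>b\<in>Basis. f b (y \<bullet> b)) \<partial>mu2)
    = (\<Prod>b\<in>Basis. \<integral>\<^sup>+t. ennreal (std_normal_density t) * f b t \<partial>lborel)"
proof -
  have "(\<integral>\<^sup>+y. (\<Prod>b\<in>Basis. f b (y \<bullet> b)) \<partial>mu2)
      = (\<integral>\<^sup>+y. (\<Prod>b\<in>Basis. ennreal (std_normal_density (y \<bullet> b)) * f b (y \<bullet> b)) \<partial>lborel)"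
    unfolding mu2_def gaussian_density_eq_prod
    by (subst nn_integral_density) (simp_all add: prod.distrib prod_ennreal)
  also have "\<dots> = (\<Prod>b\<in>Basis. \<integral>\<^sup>+t. ennreal (std_normal_density t) * f b t \<partial>lborel)"
    by (rule nn_integral_lborel_prod) auto
  finally show ?thesis .
qed

lemma prob_space_mu2: "prob_space (mu2 :: 'a::euclidean_space measure)"
proof
  have "emeasure (mu2 :: 'a measure) (space mu2)
      = (\<integral>\<^sup>+y. (\<Prod>b\<in>(Basis :: 'a set). 1) \<partial>(mu2 :: 'a measure))"
    by simp
  also have "\<dots> = (\<Prod>b\<in>(Basis :: 'a set). \<integral>\<^sup>+t. ennreal (std_normal_density t) * 1 \<partial>lborel)"
    by (rule nn_integral_mu2_prod) simp
  also have "\<dots> = 1"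
    by (simp add: nn_integral_eq_integral)
  finally show "emeasure (mu2 :: 'a measure) (space mu2) = 1" .
qed

lemma nn_integral_mu2_inner_Basis_sq:
  fixes b :: "'a::euclidean_space"
  assumes b: "b \<in> Basis"
  shows "(\<integral>\<^sup>+y. ennreal ((y \<bullet> b)\<^sup>2) \<partial>mu2) = 1"
proof -
  let ?f = "\<lambda>c t. if c = b then ennreal (t\<^sup>2) else 1"
  have "(\<integral>\<^sup>+y. ennreal ((y \<bullet> b)\<^sup>2) \<partial>mu2) = (\<integral>\<^sup>+y. (\<Prod>c\<in>Basis. ?f c (y \<bullet> c)) \<partial>(mu2 :: 'a measure))"
    using b by (simp add: prod.delta)
  also have "\<dots> = (\<Prod>c\<in>(Basis :: 'a set). \<integral>\<^sup>+t. ennreal (std_normal_density t) * ?f c t \<partial>lborel)"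
    by (rule nn_integral_mu2_prod) simp
  also have "\<dots> = 1"
  proof (intro prod.neutral ballI)
    show "(\<integral>\<^sup>+t. ennreal (std_normal_density t) * ?f c t \<partial>lborel) = 1" for c
      using std_normal_moment_even[of 1]
      by (cases "c = b")
         (auto simp: ennreal_mult'[symmetric] nn_integral_eq_integral has_bochner_integral_iff)
  qed
  finally show ?thesis .
qed

lemma
  shows integrable_exp_norm_sq: "integrable lborel (\<lambda>y::'a::euclidean_space. exp (- ((norm y)\<^sup>2 / 2)))"
    and mu2_eq_mu1: "(mu2 :: 'a::euclidean_space measure) = mu1 (\<lambda>y. (norm y)\<^sup>2 / 2)"
proof -
  let ?c = "(2 * pi) powr (- real DIM('a) / 2)" and ?g = "\<lambda>y::'a. exp (- ((norm y)\<^sup>2 / 2))"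
  interpret mu2: prob_space "mu2 :: 'a measure"
    by (rule prob_space_mu2)
  have "(\<integral>\<^sup>+y. ennreal (?c * ?g y) \<partial>lborel) = 1"
    using mu2.emeasure_space_1 by (simp add: mu2_def emeasure_density)
  then have "has_bochner_integral lborel (\<lambda>y. ?c * ?g y) 1"
    by (intro has_bochner_integral_nn_integral) auto
  from has_bochner_integral_divide_zero[OF this, of ?c]
  have gauss: "has_bochner_integral lborel ?g (1 / ?c)"
    by simp
  then show "integrable lborel ?g"
    by (rule integrable.intros)
  show "(mu2 :: 'a measure) = mu1 (\<lambda>y. (norm y)\<^sup>2 / 2)"
    unfolding mu1_def mu2_def has_bochner_integral_integral_eq[OF gauss] by (simp add: mult.commute)
qed

interpretation mu2: prob_space "mu2 :: 'a::euclidean_space measure"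
  by (rule prob_space_mu2)

lemma sets_mu2 [measurable_cong, simp]: "sets mu2 = sets borel"
  by (simp add: mu2_def)

lemma nn_integral_mu2_orthogonal_transformation:
  fixes f :: "'a::euclidean_space \<Rightarrow> ennreal" and T :: "'a \<Rightarrow> 'a"
  assumes "f \<in> borel_measurable borel" and T: "orthogonal_transformation T"
  shows "(\<integral>\<^sup>+y. f (T y) \<partial>mu2) = (\<integral>\<^sup>+y. f y \<partial>mu2)"
  unfolding mu2_eq_mu1
  by (rule nn_integral_mu1_orthogonal_transformation[OF integrable_exp_norm_sq assms])
     (simp add: orthogonal_transformation_norm[OF T])

lemma nn_integral_mu2_inner_sq:
  fixes v :: "'a::euclidean_space"
  shows "(\<integral>\<^sup>+y. ennreal ((v \<bullet> y)\<^sup>2) \<partial>mu2) = ennreal ((norm v)\<^sup>2)"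
proof -
  define b :: 'a where "b = (SOME b. b \<in> Basis)"
  have b: "b \<in> Basis"
    unfolding b_def by (rule SOME_Basis)
  define T where "T = hyperplane_reflection (norm v *\<^sub>R b - v)"
  have T: "orthogonal_transformation T"
    unfolding T_def by (rule orthogonal_transformation_hyperplane_reflection)
  have "T (norm v *\<^sub>R b) = v"
    unfolding T_def using b by (intro hyperplane_reflection_diff) simp
  then have "v \<bullet> T y = norm v * (y \<bullet> b)" for y
    using T by (metis inner_commute inner_scaleR_left orthogonal_transformation_def)
  then have "(\<integral>\<^sup>+y. ennreal ((v \<bullet> T y)\<^sup>2) \<partial>mu2)
      = (\<integral>\<^sup>+y. ennreal ((norm v)\<^sup>2) * ennreal ((y \<bullet> b)\<^sup>2) \<partial>mu2)"
    by (simp add: power_mult_distrib ennreal_mult')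
  also have "\<dots> = ennreal ((norm v)\<^sup>2)"
    by (simp add: nn_integral_cmult nn_integral_mu2_inner_Basis_sq[OF b])
  finally show ?thesis
    using nn_integral_mu2_orthogonal_transformation[OF _ T, of "\<lambda>y. ennreal ((v \<bullet> y)\<^sup>2)"] by simp
qed

lemma pair_measure_mu2: "mu2 \<Otimes>\<^sub>M mu2 = (mu2 :: ('a::euclidean_space \<times> 'b::euclidean_space) measure)"
proof -
  have "(norm p)\<^sup>2 / 2 = (norm (fst p))\<^sup>2 / 2 + (norm (snd p))\<^sup>2 / 2" for p :: "'a \<times> 'b"
    by (simp add: norm_prod_def add_divide_distrib)
  then show ?thesis
    unfolding mu2_eq_mu1 by (simp add: pair_measure_mu1 integrable_exp_norm_sq add_divide_distrib)
qed

lemma mu_eq_mu1_Hfun: "mu U = mu1 (Hfun U)"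
  by (simp add: mu_def mu1_def)

lemma mu_eq_pair_measure:
  assumes "integrable lborel (\<lambda>x. exp (- U x))"
  shows "mu U = mu1 U \<Otimes>\<^sub>M mu2"
  unfolding mu2_eq_mu1
  by (simp add: pair_measure_mu1[OF assms integrable_exp_norm_sq] mu_eq_mu1_Hfun Hfun_def[abs_def])

lemma sets_mu [measurable_cong, simp]: "sets (mu U) = sets borel"
  by (simp add: mu_def)

lemma prob_space_mu:
  assumes "integrable lborel (\<lambda>x. exp (- U x))"
  shows "prob_space (mu U)"
  unfolding mu_eq_mu1_Hfun Hfun_def[abs_def]
  by (intro prob_space_mu1 integrable_exp_add[OF assms integrable_exp_norm_sq])

section \<open>The Gaussian Poincare inequality\<close>

lemma increment_sq_le_nn_integral_deriv_sq:
  fixes \<phi> \<phi>' :: "real \<Rightarrow> real"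
  assumes "a \<le> b"
    and deriv: "\<And>t. a \<le> t \<Longrightarrow> t \<le> b \<Longrightarrow> (\<phi> has_real_derivative \<phi>' t) (at t within {a..b})"
    and "continuous_on {a..b} \<phi>'"
  shows "ennreal ((\<phi> b - \<phi> a)\<^sup>2)
    \<le> ennreal (b - a) * (\<integral>\<^sup>+t\<in>{a..b}. ennreal ((\<phi>' t)\<^sup>2) \<partial>lborel)"
proof -
  let ?\<psi> = "\<lambda>t. indicator {a..b} t *\<^sub>R \<phi>' t"
  have FTC: "has_bochner_integral lborel ?\<psi> (\<phi> b - \<phi> a)"
    using assms
    by (intro has_bochner_integral_FTC_Icc)
       (simp_all add: has_real_derivative_iff_has_vector_derivative)
  then have int: "integrable lborel ?\<psi>"
    by (rule integrable.intros)
  note [measurable] = borel_measurable_integrable[OF int, simplified]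
  have "ennreal ((\<phi> b - \<phi> a)\<^sup>2) = (ennreal \<bar>\<phi> b - \<phi> a\<bar>)\<^sup>2"
    by (simp add: ennreal_power)
  also have "\<dots> \<le> (\<integral>\<^sup>+t. ennreal \<bar>?\<psi> t\<bar> \<partial>lborel)\<^sup>2"
    using integral_norm_bound_ennreal[OF int] has_bochner_integral_integral_eq[OF FTC]
    by (intro power_mono) auto
  also have "\<dots> = (\<integral>\<^sup>+t. indicator {a..b} t * ennreal \<bar>?\<psi> t\<bar> \<partial>lborel)\<^sup>2"
    by (intro arg_cong[where f="\<lambda>I. I\<^sup>2"] nn_integral_cong) (simp split: split_indicator)
  also have "\<dots> \<le> (\<integral>\<^sup>+t. (indicator {a..b} t)\<^sup>2 \<partial>lborel) * (\<integral>\<^sup>+t. (ennreal \<bar>?\<psi> t\<bar>)\<^sup>2 \<partial>lborel)"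
    by (rule Cauchy_Schwarz_nn_integral) auto
  also have "(\<integral>\<^sup>+t. (indicator {a..b} t :: ennreal)\<^sup>2 \<partial>lborel) = ennreal (b - a)"
    using \<open>a \<le> b\<close>
    by (subst nn_integral_cong[where v="indicator {a..b}"]) (auto split: split_indicator)
  also have "(\<integral>\<^sup>+t. (ennreal \<bar>?\<psi> t\<bar>)\<^sup>2 \<partial>lborel) = (\<integral>\<^sup>+t\<in>{a..b}. ennreal ((\<phi>' t)\<^sup>2) \<partial>lborel)"
    by (intro nn_integral_cong) (simp add: ennreal_power split: split_indicator)
  finally show ?thesis .
qed

definition rotation :: "real \<Rightarrow> 'a::real_vector \<times> 'a \<Rightarrow> 'a \<times> 'a" where
  "rotation t p = (cos t *\<^sub>R fst p + sin t *\<^sub>R snd p, cos t *\<^sub>R snd p - sin t *\<^sub>R fst p)"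

lemma orthogonal_transformation_rotation:
  "orthogonal_transformation (rotation t :: 'a::euclidean_space \<times> 'a \<Rightarrow> 'a \<times> 'a)"
proof -
  have "(a *\<^sub>R x + b *\<^sub>R y) \<bullet> (a *\<^sub>R x + b *\<^sub>R y) + (a *\<^sub>R y - b *\<^sub>R x) \<bullet> (a *\<^sub>R y - b *\<^sub>R x)
      = (a\<^sup>2 + b\<^sup>2) * (x \<bullet> x + y \<bullet> y)" for x y :: 'a and a b
    by (simp add: inner_add_left inner_add_right inner_diff_left inner_diff_right inner_commute
        power2_eq_square algebra_simps)
  then have "norm (rotation t p) = norm p" for p :: "'a \<times> 'a"
    by (simp add: norm_eq inner_prod_def rotation_def)
  moreover have "linear (rotation t :: 'a \<times> 'a \<Rightarrow> 'a \<times> 'a)"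
    by (simp add: linear_iff rotation_def algebra_simps)
  ultimately show ?thesis
    by (simp add: orthogonal_transformation)
qed

lemma continuous_on_rotation [continuous_intros]:
  fixes q :: "'b::t2_space \<Rightarrow> 'a::real_normed_vector \<times> 'a"
  shows "continuous_on S s \<Longrightarrow> continuous_on S q \<Longrightarrow> continuous_on S (\<lambda>x. rotation (s x) (q x))"
  unfolding rotation_def by (intro continuous_intros)

lemma borel_measurable_rotation [measurable (raw)]:
  fixes q :: "'b \<Rightarrow> 'a::euclidean_space \<times> 'a"
  assumes "s \<in> borel_measurable M" "q \<in> borel_measurable M"
  shows "(\<lambda>x. rotation (s x) (q x)) \<in> borel_measurable M"
  using assms by (rule borel_measurable_continuous_Pair) (intro continuous_intros)

lemma has_vector_derivative_fst_rotation:
  fixes p :: "'a::real_normed_vector \<times> 'a"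
  shows "((\<lambda>t. fst (rotation t p)) has_vector_derivative snd (rotation t p)) (at t within S)"
  unfolding rotation_def by (auto intro!: derivative_eq_intros)

lemma increment_sq_le_nn_integral_rotation:
  fixes f :: "'a::euclidean_space \<Rightarrow> real"
  assumes f: "smooth f"
  shows "ennreal ((f (snd p) - f (fst p))\<^sup>2) \<le> ennreal (pi / 2) *
    (\<integral>\<^sup>+t\<in>{0..pi/2}. ennreal ((gradient f (fst (rotation t p)) \<bullet> snd (rotation t p))\<^sup>2) \<partial>lborel)"
proof -
  let ?\<phi> = "\<lambda>t. f (fst (rotation t p))"
    and ?\<phi>' = "\<lambda>t. gradient f (fst (rotation t p)) \<bullet> snd (rotation t p)"
  have deriv: "(?\<phi> has_real_derivative ?\<phi>' t) (at t within S)" for t S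
    using has_derivative_compose[OF
        has_vector_derivative_fst_rotation[unfolded has_vector_derivative_def]
        smooth_has_derivative[OF f]]
    by (simp add: has_field_derivative_def mult_commute_abs)
  have "continuous_on S ?\<phi>'" for S
    by (intro continuous_intros continuous_on_compose2[OF continuous_on_gradient[OF f, of UNIV]]) auto
  from increment_sq_le_nn_integral_deriv_sq[of 0 "pi/2", OF _ deriv this]
  show ?thesis
    by (simp add: rotation_def)
qed

lemma nn_integral_mu2_gradient_inner_sq:
  fixes f :: "'a::euclidean_space \<Rightarrow> real"
  assumes f: "smooth f"
  shows "(\<integral>\<^sup>+p. ennreal ((gradient f (fst p) \<bullet> snd p)\<^sup>2) \<partial>mu2) = (\<integral>\<^sup>+y. ennreal (grad_sq f y) \<partial>mu2)"
proof -
  note [measurable] = gradient_borel_measurable[OF f]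
  have "(\<integral>\<^sup>+p. ennreal ((gradient f (fst p) \<bullet> snd p)\<^sup>2) \<partial>mu2)
      = (\<integral>\<^sup>+y. \<integral>\<^sup>+z. ennreal ((gradient f y \<bullet> z)\<^sup>2) \<partial>mu2 \<partial>mu2)"
    unfolding pair_measure_mu2[symmetric] by (subst mu2.nn_integral_fst[symmetric]) auto
  also have "\<dots> = (\<integral>\<^sup>+y. ennreal (grad_sq f y) \<partial>mu2)"
    by (simp add: nn_integral_mu2_inner_sq grad_sq_eq_norm_gradient)
  finally show ?thesis .
qed

lemma nn_integral_mu2_rotation_arc:
  fixes g :: "'a::euclidean_space \<times> 'a \<Rightarrow> real"
  assumes [measurable]: "g \<in> borel_measurable borel" and "a \<le> b"
  shows "(\<integral>\<^sup>+p. (\<integral>\<^sup>+t\<in>{a..b}. ennreal ((g (rotation t p))\<^sup>2) \<partial>lborel) \<partial>mu2)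
    = ennreal (b - a) * (\<integral>\<^sup>+p. ennreal ((g p)\<^sup>2) \<partial>mu2)"
proof -
  interpret pair_sigma_finite lborel "mu2 :: ('a \<times> 'a) measure" ..
  have g_rotation: "(\<integral>\<^sup>+p. ennreal ((g (rotation t p))\<^sup>2) \<partial>mu2) = (\<integral>\<^sup>+p. ennreal ((g p)\<^sup>2) \<partial>mu2)" for t
    by (rule nn_integral_mu2_orthogonal_transformation[OF _ orthogonal_transformation_rotation])
       measurable
  have "(\<integral>\<^sup>+p. (\<integral>\<^sup>+t\<in>{a..b}. ennreal ((g (rotation t p))\<^sup>2) \<partial>lborel) \<partial>mu2)
      = (\<integral>\<^sup>+t. (\<integral>\<^sup>+p. ennreal ((g (rotation t p))\<^sup>2) * indicator {a..b} t \<partial>mu2) \<partial>lborel)"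
    by (rule Fubini') measurable
  also have "\<dots> = ennreal (b - a) * (\<integral>\<^sup>+p. ennreal ((g p)\<^sup>2) \<partial>mu2)"
    using \<open>a \<le> b\<close> by (simp add: nn_integral_multc g_rotation nn_integral_cmult mult.commute)
  finally show ?thesis .
qed

lemma gaussian_poincare:
  fixes f :: "'a::euclidean_space \<Rightarrow> real"
  assumes f: "smooth f"
  shows "nn_variance mu2 f \<le> ennreal (pi\<^sup>2 / 8) * (\<integral>\<^sup>+y. ennreal (grad_sq f y) \<partial>mu2)"
proof -
  note [measurable] = smooth_borel_measurable[OF f]
  define D where "D = (\<lambda>p. gradient f (fst p) \<bullet> snd p)"
  have [measurable]: "D \<in> borel_measurable borel"
    unfolding D_def
    by (intro borel_measurable_continuous_onI continuous_intros
        continuous_on_compose2[OF continuous_on_gradient[OF f, of UNIV]]) auto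
  have pi_sq: "ennreal (pi / 2) * ennreal (pi / 2) = ennreal 2 * ennreal (pi\<^sup>2 / 8)"
    by (subst (1 2) ennreal_mult'[symmetric]) (auto simp: power2_eq_square)
  have "2 * nn_variance mu2 f = (\<integral>\<^sup>+p. ennreal ((f (snd p) - f (fst p))\<^sup>2) \<partial>mu2)"
    unfolding pair_measure_mu2[symmetric]
    by (subst mu2.nn_integral_fst[symmetric]) (simp_all add: mu2.nn_integral_increment_sq)
  also have "\<dots> \<le> (\<integral>\<^sup>+p. ennreal (pi / 2)
      * (\<integral>\<^sup>+t\<in>{0..pi/2}. ennreal ((D (rotation t p))\<^sup>2) \<partial>lborel) \<partial>mu2)"
    unfolding D_def by (intro nn_integral_mono increment_sq_le_nn_integral_rotation f)
  also have "\<dots> = ennreal (pi / 2) * (ennreal (pi / 2) * (\<integral>\<^sup>+p. ennreal ((D p)\<^sup>2) \<partial>mu2))"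
    by (simp add: nn_integral_cmult nn_integral_mu2_rotation_arc)
  also have "\<dots> = ennreal 2 * (ennreal (pi\<^sup>2 / 8) * (\<integral>\<^sup>+y. ennreal (grad_sq f y) \<partial>mu2))"
    unfolding D_def nn_integral_mu2_gradient_inner_sq[OF f] by (simp only: mult.assoc[symmetric] pi_sq)
  finally show ?thesis
    by (simp add: ennreal_mult_le_mult_iff)
qed

section \<open>The weighted Poincare inequality on a product\<close>

lemma power2_add_le_weighted:
  fixes r s \<epsilon> :: real
  assumes "0 < \<epsilon>"
  shows "(r + s)\<^sup>2 \<le> (1 + \<epsilon>) * r\<^sup>2 + (1 + 1 / \<epsilon>) * s\<^sup>2"
proof -
  have "0 \<le> (\<epsilon> * r - s)\<^sup>2 / \<epsilon>"
    using assms by simp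
  also have "\<dots> = (1 + \<epsilon>) * r\<^sup>2 + (1 + 1 / \<epsilon>) * s\<^sup>2 - (r + s)\<^sup>2"
    using assms by (simp add: power2_eq_square field_simps)
  finally show ?thesis by simp
qed

lemma (in pair_prob_space) nn_variance_pair_le_slice:
  fixes h :: "'a \<times> 'b \<Rightarrow> real"
  assumes [measurable]: "h \<in> borel_measurable (M1 \<Otimes>\<^sub>M M2)" and [measurable]: "z \<in> space M2"
    and "0 < \<epsilon>"
  shows "nn_variance (M1 \<Otimes>\<^sub>M M2) h
    \<le> ennreal (1 + \<epsilon>) * (\<integral>\<^sup>+x. \<integral>\<^sup>+y. ennreal ((h (x, y) - h (x, z))\<^sup>2) \<partial>M2 \<partial>M1)
      + ennreal (1 + 1 / \<epsilon>) * nn_variance M1 (\<lambda>x. h (x, z))"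
proof -
  define c where "c = (\<integral>x. h (x, z) \<partial>M1)"
  have split: "ennreal ((h (x, y) - c)\<^sup>2) \<le> ennreal (1 + \<epsilon>) * ennreal ((h (x, y) - h (x, z))\<^sup>2)
      + ennreal (1 + 1 / \<epsilon>) * ennreal ((h (x, z) - c)\<^sup>2)" for x y
    using power2_add_le_weighted[OF \<open>0 < \<epsilon>\<close>, of "h (x, y) - h (x, z)" "h (x, z) - c"] \<open>0 < \<epsilon>\<close>
    by (simp add: ennreal_mult'[symmetric] ennreal_plus[symmetric] ennreal_leI del: ennreal_plus)
  have "nn_variance (M1 \<Otimes>\<^sub>M M2) h \<le> (\<integral>\<^sup>+x. \<integral>\<^sup>+y. ennreal ((h (x, y) - c)\<^sup>2) \<partial>M2 \<partial>M1)"
    using P.nn_variance_le_nn_integral[of h c] by (simp add: M2.nn_integral_fst[symmetric])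
  also have "\<dots> \<le> (\<integral>\<^sup>+x. \<integral>\<^sup>+y. ennreal (1 + \<epsilon>) * ennreal ((h (x, y) - h (x, z))\<^sup>2)
      + ennreal (1 + 1 / \<epsilon>) * ennreal ((h (x, z) - c)\<^sup>2) \<partial>M2 \<partial>M1)"
    by (intro nn_integral_mono split)
  also have "\<dots> = (\<integral>\<^sup>+x. ennreal (1 + \<epsilon>) * (\<integral>\<^sup>+y. ennreal ((h (x, y) - h (x, z))\<^sup>2) \<partial>M2)
      + ennreal (1 + 1 / \<epsilon>) * ennreal ((h (x, z) - c)\<^sup>2) \<partial>M1)"
    by (intro nn_integral_cong) (simp add: nn_integral_add nn_integral_cmult M2.emeasure_space_1)
  also have "\<dots> = ennreal (1 + \<epsilon>) * (\<integral>\<^sup>+x. \<integral>\<^sup>+y. ennreal ((h (x, y) - h (x, z))\<^sup>2) \<partial>M2 \<partial>M1)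
      + ennreal (1 + 1 / \<epsilon>) * nn_variance M1 (\<lambda>x. h (x, z))"
    by (simp add: nn_integral_add nn_integral_cmult nn_variance_def c_def)
  finally show ?thesis .
qed

lemma (in pair_prob_space) nn_integral_slice_increment_sq:
  fixes h :: "'a \<times> 'b \<Rightarrow> real"
  assumes [measurable]: "h \<in> borel_measurable (M1 \<Otimes>\<^sub>M M2)"
  shows "(\<integral>\<^sup>+z. \<integral>\<^sup>+x. \<integral>\<^sup>+y. ennreal ((h (x, y) - h (x, z))\<^sup>2) \<partial>M2 \<partial>M1 \<partial>M2)
    = 2 * (\<integral>\<^sup>+x. nn_variance M2 (\<lambda>y. h (x, y)) \<partial>M1)"
proof -
  have "(\<integral>\<^sup>+z. \<integral>\<^sup>+x. \<integral>\<^sup>+y. ennreal ((h (x, y) - h (x, z))\<^sup>2) \<partial>M2 \<partial>M1 \<partial>M2)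
      = (\<integral>\<^sup>+x. \<integral>\<^sup>+z. \<integral>\<^sup>+y. ennreal ((h (x, y) - h (x, z))\<^sup>2) \<partial>M2 \<partial>M2 \<partial>M1)"
    by (rule Fubini') measurable
  also have "\<dots> = (\<integral>\<^sup>+x. 2 * nn_variance M2 (\<lambda>y. h (x, y)) \<partial>M1)"
    by (intro nn_integral_cong M2.nn_integral_increment_sq) measurable
  also have "\<dots> = 2 * (\<integral>\<^sup>+x. nn_variance M2 (\<lambda>y. h (x, y)) \<partial>M1)"
    unfolding nn_variance_def by (rule nn_integral_cmult) measurable
  finally show ?thesis .
qed

lemma (in pair_prob_space) weighted_nn_variance_pair_le:
  fixes h :: "'a \<times> 'b \<Rightarrow> real" and w :: "'b \<Rightarrow> ennreal"
  assumes h [measurable]: "h \<in> borel_measurable (M1 \<Otimes>\<^sub>M M2)" and [measurable]: "w \<in> borel_measurable M2"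
    and w_le_1: "\<And>y. w y \<le> 1" and "0 < \<epsilon>"
  shows "(\<integral>\<^sup>+y. w y \<partial>M2) * nn_variance (M1 \<Otimes>\<^sub>M M2) h
    \<le> 2 * ennreal (1 + \<epsilon>) * (\<integral>\<^sup>+x. nn_variance M2 (\<lambda>y. h (x, y)) \<partial>M1)
      + ennreal (1 + 1 / \<epsilon>) * (\<integral>\<^sup>+y. w y * nn_variance M1 (\<lambda>x. h (x, y)) \<partial>M2)"
proof -
  define S where "S z = (\<integral>\<^sup>+x. \<integral>\<^sup>+y. ennreal ((h (x, y) - h (x, z))\<^sup>2) \<partial>M2 \<partial>M1)" for z
  define V where "V z = nn_variance M1 (\<lambda>x. h (x, z))" for z
  have [measurable]: "S \<in> borel_measurable M2" "V \<in> borel_measurable M2"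
    unfolding S_def V_def nn_variance_def by measurable
  have slice: "nn_variance (M1 \<Otimes>\<^sub>M M2) h \<le> ennreal (1 + \<epsilon>) * S z + ennreal (1 + 1 / \<epsilon>) * V z"
    if "z \<in> space M2" for z
    unfolding S_def V_def by (rule nn_variance_pair_le_slice[OF h that \<open>0 < \<epsilon>\<close>])
  have "(\<integral>\<^sup>+y. w y \<partial>M2) * nn_variance (M1 \<Otimes>\<^sub>M M2) h
      = (\<integral>\<^sup>+z. w z * nn_variance (M1 \<Otimes>\<^sub>M M2) h \<partial>M2)"
    by (simp add: nn_integral_multc)
  also have "\<dots> \<le> (\<integral>\<^sup>+z. w z * (ennreal (1 + \<epsilon>) * S z + ennreal (1 + 1 / \<epsilon>) * V z) \<partial>M2)"
    by (intro nn_integral_mono mult_left_mono slice) auto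
  also have "\<dots> = (\<integral>\<^sup>+z. w z * (ennreal (1 + \<epsilon>) * S z) + ennreal (1 + 1 / \<epsilon>) * (w z * V z) \<partial>M2)"
    by (simp only: distrib_left mult.left_commute)
  also have "\<dots> \<le> (\<integral>\<^sup>+z. 1 * (ennreal (1 + \<epsilon>) * S z) + ennreal (1 + 1 / \<epsilon>) * (w z * V z) \<partial>M2)"
    by (intro nn_integral_mono add_mono mult_right_mono w_le_1) auto
  also have "\<dots> = ennreal (1 + \<epsilon>) * (\<integral>\<^sup>+z. S z \<partial>M2) + ennreal (1 + 1 / \<epsilon>) * (\<integral>\<^sup>+z. w z * V z \<partial>M2)"
    by (simp add: nn_integral_add nn_integral_cmult)
  also have "ennreal (1 + \<epsilon>) * (\<integral>\<^sup>+z. S z \<partial>M2)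
      = 2 * ennreal (1 + \<epsilon>) * (\<integral>\<^sup>+x. nn_variance M2 (\<lambda>y. h (x, y)) \<partial>M1)"
    by (simp only: S_def nn_integral_slice_increment_sq[OF h] mult_ac)
  finally show ?thesis
    by (simp only: V_def)
qed

lemma (in pair_prob_space) weighted_poincare_pair_measure:
  fixes h :: "'a \<times> 'b \<Rightarrow> real" and v A B :: "'a \<times> 'b \<Rightarrow> ennreal" and w :: "'b \<Rightarrow> ennreal"
  assumes [measurable]: "h \<in> borel_measurable (M1 \<Otimes>\<^sub>M M2)" "v \<in> borel_measurable (M1 \<Otimes>\<^sub>M M2)"
      "A \<in> borel_measurable (M1 \<Otimes>\<^sub>M M2)" "B \<in> borel_measurable (M1 \<Otimes>\<^sub>M M2)"
      "w \<in> borel_measurable M2"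
    and poincare1: "\<And>y. nn_variance M1 (\<lambda>x. h (x, y)) \<le> C * (\<integral>\<^sup>+x. v (x, y) \<partial>M1)"
    and poincare2: "\<And>x. nn_variance M2 (\<lambda>y. h (x, y)) \<le> K * (\<integral>\<^sup>+y. B (x, y) \<partial>M2)"
    and w_le_1: "\<And>y. w y \<le> 1" and weight_le: "\<And>x y. w y * v (x, y) \<le> A (x, y)"
    and "0 < \<epsilon>"
  shows "(\<integral>\<^sup>+y. w y \<partial>M2) * nn_variance (M1 \<Otimes>\<^sub>M M2) h
    \<le> 2 * ennreal (1 + \<epsilon>) * (K * (\<integral>\<^sup>+p. B p \<partial>(M1 \<Otimes>\<^sub>M M2)))
      + ennreal (1 + 1 / \<epsilon>) * (C * (\<integral>\<^sup>+p. A p \<partial>(M1 \<Otimes>\<^sub>M M2)))"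
proof -
  have B_bound: "(\<integral>\<^sup>+x. nn_variance M2 (\<lambda>y. h (x, y)) \<partial>M1) \<le> K * (\<integral>\<^sup>+p. B p \<partial>(M1 \<Otimes>\<^sub>M M2))"
  proof -
    have "(\<integral>\<^sup>+x. nn_variance M2 (\<lambda>y. h (x, y)) \<partial>M1) \<le> (\<integral>\<^sup>+x. K * (\<integral>\<^sup>+y. B (x, y) \<partial>M2) \<partial>M1)"
      by (intro nn_integral_mono poincare2)
    also have "\<dots> = K * (\<integral>\<^sup>+p. B p \<partial>(M1 \<Otimes>\<^sub>M M2))"
      by (simp add: nn_integral_cmult M2.nn_integral_fst)
    finally show ?thesis .
  qed
  have A_bound: "(\<integral>\<^sup>+y. w y * nn_variance M1 (\<lambda>x. h (x, y)) \<partial>M2) \<le> C * (\<integral>\<^sup>+p. A p \<partial>(M1 \<Otimes>\<^sub>M M2))"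
  proof -
    have "(\<integral>\<^sup>+y. w y * nn_variance M1 (\<lambda>x. h (x, y)) \<partial>M2)
        \<le> (\<integral>\<^sup>+y. w y * (C * (\<integral>\<^sup>+x. v (x, y) \<partial>M1)) \<partial>M2)"
      by (intro nn_integral_mono mult_left_mono poincare1) simp
    also have "\<dots> = (\<integral>\<^sup>+y. C * (\<integral>\<^sup>+x. w y * v (x, y) \<partial>M1) \<partial>M2)"
      by (intro nn_integral_cong) (simp add: nn_integral_cmult mult.left_commute)
    also have "\<dots> \<le> (\<integral>\<^sup>+y. C * (\<integral>\<^sup>+x. A (x, y) \<partial>M1) \<partial>M2)"
      by (intro nn_integral_mono mult_left_mono weight_le) simp
    also have "\<dots> = C * (\<integral>\<^sup>+p. A p \<partial>(M1 \<Otimes>\<^sub>M M2))"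
      by (simp add: nn_integral_cmult nn_integral_snd)
    finally show ?thesis .
  qed
  show ?thesis
    by (rule order.trans[OF weighted_nn_variance_pair_le[OF _ _ w_le_1 \<open>0 < \<epsilon>\<close>]])
       (auto intro!: add_mono mult_left_mono A_bound B_bound)
qed

definition kinetic_weight :: "real \<Rightarrow> 'a::euclidean_space \<Rightarrow> real" where
  "kinetic_weight \<eta> y = (1 + (norm y)\<^sup>2 / 2) powr (- 2 * \<eta>)"

lemma kinetic_weight_pos: "0 < kinetic_weight \<eta> y"
  using add_pos_nonneg[of 1 "(norm y)\<^sup>2 / 2"] by (simp add: kinetic_weight_def)

lemma kinetic_weight_le_1: "0 \<le> \<eta> \<Longrightarrow> kinetic_weight \<eta> y \<le> 1"
  using powr_mono2'[of "- 2 * \<eta>" 1 "1 + (norm y)\<^sup>2 / 2"] by (simp add: kinetic_weight_def)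

lemma kinetic_weight_borel_measurable [measurable]: "kinetic_weight \<eta> \<in> borel_measurable borel"
  unfolding kinetic_weight_def by measurable

lemma integrable_kinetic_weight: "0 \<le> \<eta> \<Longrightarrow> integrable mu2 (kinetic_weight \<eta>)"
  by (rule mu2.integrable_const_bound[where B=1])
     (auto simp: kinetic_weight_le_1 less_imp_le[OF kinetic_weight_pos])

lemma integral_kinetic_weight_pos:
  "0 \<le> \<eta> \<Longrightarrow> 0 < (\<integral>y. kinetic_weight \<eta> y \<partial>(mu2 :: 'a::euclidean_space measure))"
  by (rule integral_pos[OF integrable_kinetic_weight kinetic_weight_pos])
     (simp_all add: mu2.emeasure_space_1[simplified])

lemma kinetic_weight_mult_powr_le:
  assumes "1 \<le> U (fst p)" "0 \<le> \<eta>"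
  shows "kinetic_weight \<eta> (snd p) * U (fst p) powr (- 2 * \<eta>) \<le> Hfun U p powr (- 2 * \<eta>)"
proof -
  let ?s = "(norm (snd p))\<^sup>2 / 2"
  have "1 * ?s \<le> U (fst p) * ?s"
    using assms by (intro mult_right_mono) auto
  then have "Hfun U p \<le> (1 + ?s) * U (fst p)"
    by (simp add: Hfun_def algebra_simps)
  moreover have "0 < Hfun U p"
    using assms by (auto simp: Hfun_def intro: add_pos_nonneg)
  ultimately have "((1 + ?s) * U (fst p)) powr (- 2 * \<eta>) \<le> Hfun U p powr (- 2 * \<eta>)"
    using assms by (intro powr_mono2') auto
  then show ?thesis
    using assms by (simp add: powr_mult kinetic_weight_def)
qed

lemma weighted_nn_variance_mu_le:
  fixes U :: "'a::euclidean_space \<Rightarrow> real" and h :: "'a \<times> 'a \<Rightarrow> real"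
  assumes [measurable]: "U \<in> borel_measurable borel" and U_ge1: "\<And>x. 1 \<le> U x"
    and U_int: "integrable lborel (\<lambda>x. exp (- U x))" and eta: "0 \<le> \<eta>"
    and poincare: "\<And>f. smooth f \<Longrightarrow> nn_variance (mu1 U) f
      \<le> C * (\<integral>\<^sup>+x. ennreal (U x powr (- 2 * \<eta>) * grad_sq f x) \<partial>mu1 U)"
    and h: "smooth h" and "0 < \<epsilon>"
  shows "(\<integral>\<^sup>+y. ennreal (kinetic_weight \<eta> y) \<partial>(mu2 :: 'a measure)) * nn_variance (mu U) h
    \<le> 2 * ennreal (1 + \<epsilon>) * (ennreal (pi\<^sup>2 / 8) * (\<integral>\<^sup>+p. ennreal (grad_y_sq h p) \<partial>mu U))
      + ennreal (1 + 1 / \<epsilon>) * (C * (\<integral>\<^sup>+p. ennreal (Hfun U p powr (- 2 * \<eta>) * grad_x_sq h p) \<partial>mu U))"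
proof -
  interpret mu1: prob_space "mu1 U"
    by (rule prob_space_mu1[OF U_int])
  interpret pair_prob_space "mu1 U" "mu2 :: 'a measure" ..
  have [measurable]: "h \<in> borel_measurable (borel \<Otimes>\<^sub>M borel)"
    "grad_x_sq h \<in> borel_measurable (borel \<Otimes>\<^sub>M borel)"
    "grad_y_sq h \<in> borel_measurable (borel \<Otimes>\<^sub>M borel)"
    unfolding borel_prod using h
    by (auto intro: smooth_borel_measurable grad_x_sq_borel_measurable grad_y_sq_borel_measurable)
  have [measurable]: "Hfun U \<in> borel_measurable (borel \<Otimes>\<^sub>M borel)"
    unfolding Hfun_def[abs_def] by measurable
  have "ennreal (kinetic_weight \<eta> y) * ennreal (U x powr (- 2 * \<eta>) * grad_x_sq h (x, y))
      \<le> ennreal (Hfun U (x, y) powr (- 2 * \<eta>) * grad_x_sq h (x, y))" for x y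
    using kinetic_weight_mult_powr_le[of U "(x, y)" \<eta>] U_ge1 eta kinetic_weight_pos[of \<eta> y]
    by (simp add: ennreal_mult'[symmetric] mult.assoc[symmetric] mult_right_mono ennreal_leI)
  then show ?thesis
    unfolding mu_eq_pair_measure[OF U_int]
    using poincare[OF smooth_slice_fst[OF h]] gaussian_poincare[OF smooth_slice_snd[OF h]]
    by (intro weighted_poincare_pair_measure[
          where v="\<lambda>p. ennreal (U (fst p) powr (- 2 * \<eta>) * grad_x_sq h p)"])
       (auto simp: grad_sq_slice_fst[OF h] grad_sq_slice_snd[OF h] kinetic_weight_le_1[OF eta] \<open>0 < \<epsilon>\<close>)
qed

lemma nn_variance_mu_le_nn_integral:
  fixes U :: "'a::euclidean_space \<Rightarrow> real" and h :: "'a \<times> 'a \<Rightarrow> real" and \<eta> C D :: real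
  defines "m \<equiv> \<integral>y. kinetic_weight \<eta> y \<partial>(mu2 :: 'a measure)"
  assumes U [measurable]: "U \<in> borel_measurable borel" and U_ge1: "\<And>x. 1 \<le> U x"
    and U_int: "integrable lborel (\<lambda>x. exp (- U x))" and eta: "0 \<le> \<eta>"
    and poincare: "\<And>f. smooth f \<Longrightarrow> nn_variance (mu1 U) f
      \<le> ennreal C * (\<integral>\<^sup>+x. ennreal (U x powr (- 2 * \<eta>) * grad_sq f x) \<partial>mu1 U)"
    and D: "4 \<le> m * D" "4 * C \<le> m * D"
    and h: "smooth h"
  shows "nn_variance (mu U) h
    \<le> ennreal D * (\<integral>\<^sup>+p. ennreal (Hfun U p powr (- 2 * \<eta>) * grad_x_sq h p + grad_y_sq h p) \<partial>mu U)"
    (is "_ \<le> _ * ?E")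
proof -
  let ?A = "\<integral>\<^sup>+p. ennreal (Hfun U p powr (- 2 * \<eta>) * grad_x_sq h p) \<partial>mu U"
    and ?B = "\<integral>\<^sup>+p. ennreal (grad_y_sq h p) \<partial>mu U"
  have "0 < m"
    unfolding m_def by (rule integral_kinetic_weight_pos[OF eta])
  have m: "(\<integral>\<^sup>+y. ennreal (kinetic_weight \<eta> y) \<partial>(mu2 :: 'a measure)) = ennreal m"
    unfolding m_def using integrable_kinetic_weight[OF eta] kinetic_weight_pos
    by (intro nn_integral_eq_integral) (auto intro: less_imp_le)
  have [measurable]: "Hfun U \<in> borel_measurable (borel :: ('a \<times> 'a) measure)"
    unfolding borel_prod[symmetric] Hfun_def[abs_def] by measurable
  note [measurable] = grad_x_sq_borel_measurable[OF h] grad_y_sq_borel_measurable[OF h]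
  have energy: "?E = ?B + ?A"
    by (subst nn_integral_add[symmetric])
       (auto simp: ennreal_plus[symmetric] add.commute simp del: ennreal_plus)
  have "pi\<^sup>2 \<le> (16 / 5)\<^sup>2"
    using pi_approx(2) by (intro power_mono) auto
  then have pi_le: "2 * (4 / 3) * (pi\<^sup>2 / 8) \<le> m * D"
    using D(1) by (simp add: power2_eq_square)
  have "ennreal m * nn_variance (mu U) h
      \<le> 2 * ennreal (1 + 1 / 3) * (ennreal (pi\<^sup>2 / 8) * ?B)
        + ennreal (1 + 1 / (1 / 3)) * (ennreal C * ?A)"
    unfolding m[symmetric] by (rule weighted_nn_variance_mu_le[OF U U_ge1 U_int eta poincare h]) auto
  also have "2 * ennreal (1 + 1 / 3) * (ennreal (pi\<^sup>2 / 8) * ?B)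
      = ennreal (2 * (4 / 3) * (pi\<^sup>2 / 8)) * ?B"
    by (subst ennreal_mult', simp, subst ennreal_mult') (simp_all add: mult.assoc)
  also have "ennreal (1 + 1 / (1 / 3)) * (ennreal C * ?A) = ennreal (4 * C) * ?A"
    by (subst ennreal_mult') (simp_all add: mult.assoc)
  also have "ennreal (2 * (4 / 3) * (pi\<^sup>2 / 8)) * ?B + ennreal (4 * C) * ?A
      \<le> ennreal (m * D) * ?B + ennreal (m * D) * ?A"
    using pi_le D(2) by (intro add_mono mult_right_mono ennreal_leI) auto
  also have "\<dots> = ennreal m * (ennreal D * ?E)"
    unfolding energy using \<open>0 < m\<close> by (simp add: distrib_left ennreal_mult' mult.assoc)
  finally show ?thesis
    using \<open>0 < m\<close> by (simp add: ennreal_mult_le_mult_iff)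
qed

theorem theorem8:
  fixes U :: "'a::euclidean_space \<Rightarrow> real" and \<eta> C1 :: real
  assumes U_smooth: "smooth U"
    and U_ge1: "\<And>x. U x \<ge> 1"
    and U_int: "integrable lborel (\<lambda>x. exp (- U x))"
    and eta: "\<eta> \<ge> 0"
    and WP: "\<And>f :: 'a \<Rightarrow> real. smooth f \<Longrightarrow>
       Var (mu1 U) f \<le> ereal C1 *
         enn2ereal (\<integral>\<^sup>+ x. ennreal (U x powr (- 2 * \<eta>) * grad_sq f x) \<partial>mu1 U)"
  shows "\<exists>C'. C' \<le> max (2 + 4 / (\<integral>y. (1 + (norm y)\<^sup>2 / 2) powr (- 2 * \<eta>) \<partial>(mu2 :: 'a measure)))
                          (4 * C1 / (\<integral>y. (1 + (norm y)\<^sup>2 / 2) powr (- 2 * \<eta>) \<partial>(mu2 :: 'a measure)))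
     \<and> (\<forall>h :: 'a \<times> 'a \<Rightarrow> real. smooth h \<longrightarrow>
          Var (mu U) h \<le> ereal C' *
            enn2ereal (\<integral>\<^sup>+ p. ennreal (Hfun U p powr (- 2 * \<eta>) * grad_x_sq h p + grad_y_sq h p) \<partial>mu U))"
proof -
  let ?m = "\<integral>y. kinetic_weight \<eta> y \<partial>(mu2 :: 'a measure)"
  define C' where "C' = max (2 + 4 / ?m) (4 * C1 / ?m)"
  have m_pos: "0 < ?m"
    by (rule integral_kinetic_weight_pos[OF eta])
  then have "0 \<le> 4 / ?m" "4 / ?m \<le> C'" "4 * C1 / ?m \<le> C'"
    by (simp_all add: C'_def)
  with m_pos have C': "0 \<le> C'" "4 \<le> ?m * C'" "4 * C1 \<le> ?m * C'"
    by (linarith, simp_all add: pos_divide_le_eq mult.commute)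
  interpret mu1: prob_space "mu1 U"
    by (rule prob_space_mu1[OF U_int])
  interpret mu: prob_space "mu U"
    by (rule prob_space_mu[OF U_int])
  have poincare: "nn_variance (mu1 U) f
      \<le> ennreal C1 * (\<integral>\<^sup>+x. ennreal (U x powr (- 2 * \<eta>) * grad_sq f x) \<partial>mu1 U)" if "smooth f" for f
    using smooth_borel_measurable[OF that]
    by (intro mu1.nn_variance_le_if_Var_le[OF _ WP[OF that]]) measurable
  have "Var (mu U) h \<le> ereal C' *
      enn2ereal (\<integral>\<^sup>+p. ennreal (Hfun U p powr (- 2 * \<eta>) * grad_x_sq h p + grad_y_sq h p) \<partial>mu U)"
    if "smooth h" for h :: "'a \<times> 'a \<Rightarrow> real"
    using smooth_borel_measurable[OF that]
    by (intro mu.Var_le_if_nn_variance_le[OF _ C'(1)] nn_variance_mu_le_nn_integral[OF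
          smooth_borel_measurable[OF U_smooth] U_ge1 U_int eta poincare C'(2,3) that]) measurable
  then show ?thesis
    unfolding C'_def kinetic_weight_def by blast
qed

end
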